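(* Let $f$ be a full branch piecewise $\mathcal C^r$ ($r\ge2$) expanding map of $[0,1]$ with $f'>\lambda>1$ (as in the context). If $f$ is an $N$-covering (has $N$ full branches), then $$\sigma_{\mathcal C^1}(\mathcal L_0)\subset\{N\}\cup\{z\in\mathbb C:|z|\le1\}.$$ Moreover, $$\sigma_{\mathcal C^2}(\mathcal L_0)\cap\{z\in\mathbb C:|z|\ge\lambda^{-1}\}=\{N\}\cup\big(\sigma_{\mathcal C^1}(\mathcal L_1)\cap\{z\in\mathbb C:|z|\ge\lambda^{-1}\}\big).$$
   Context: A full branch piecewise $\mathcal C^r$ expanding map $f:[0,1]\to[0,1]$ with $N$ branches: there is a partition $0=p_1<p_2<\dots<p_{N+1}=1$ such that for each $i$ the restriction of $f$ to $(p_i,p_{i+1})$ extends to a $\mathcal C^r$ map of $[p_i,p_{i+1}]$ onto $[0,1]$, and $f'>\lambda>1$ (derivatives being taken on the branches). For $k\in\{0,1,2,\dots\}$ the transfer operator is $\mathcal L_kh(x)=\sum_{y\in f^{-1}(x)}\frac{h(y)}{[f'(y)]^k}$, the sum being over the $N$ inverse branches. $\sigma_B(\mathcal L)$ denotes the spectrum of $\mathcal L$ acting on the Banach space $B$; here $\mathcal C^1=\mathcal C^1([0,1],\mathbb C)$ and $\mathcal C^2=\mathcal C^2([0,1],\mathbb C)$. *)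

theory Defs
  imports "HOL-Analysis.Analysis"
begin

text \<open>Derivatives are taken within the set, hence are one-sided at the end points of a
  closed interval.\<close>

definition iter_deriv :: "real set \<Rightarrow> nat \<Rightarrow> (real \<Rightarrow> 'a::real_normed_vector) \<Rightarrow> real \<Rightarrow> 'a" where
  "iter_deriv S j = (\<lambda>g x. vector_derivative g (at x within S)) ^^ j"

definition C_on :: "nat \<Rightarrow> real set \<Rightarrow> (real \<Rightarrow> 'a::real_normed_vector) \<Rightarrow> bool" where
  "C_on m S g \<longleftrightarrow>
     (\<forall>j<m. iter_deriv S j g differentiable_on S) \<and> continuous_on S (iter_deriv S m g)"

text \<open>A function on \<open>[0,1]\<close> is represented by its extension by zero to the real line, so that
  the carrier is a complex vector space under pointwise operations and equality of elements is
  equality on \<open>[0,1]\<close>.\<close>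

definition C_space :: "nat \<Rightarrow> (real \<Rightarrow> complex) set" where
  "C_space m = {h. C_on m {0..1} h \<and> (\<forall>x. x \<notin> {0..1} \<longrightarrow> h x = 0)}"

definition C_norm :: "nat \<Rightarrow> (real \<Rightarrow> complex) \<Rightarrow> real" where
  "C_norm m h = (\<Sum>j\<le>m. SUP x\<in>{0..1}. cmod (iter_deriv {0..1} j h x))"

definition bounded_operator_on ::
  "('a \<Rightarrow> complex) set \<Rightarrow> (('a \<Rightarrow> complex) \<Rightarrow> real) \<Rightarrow> (('a \<Rightarrow> complex) \<Rightarrow> 'a \<Rightarrow> complex) \<Rightarrow> bool"
where
  "bounded_operator_on V nrm T \<longleftrightarrow>
     T \<in> V \<rightarrow> V \<and>
     (\<forall>g\<in>V. \<forall>h\<in>V. T (\<lambda>x. g x + h x) = (\<lambda>x. T g x + T h x)) \<and>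
     (\<forall>c. \<forall>h\<in>V. T (\<lambda>x. c * h x) = (\<lambda>x. c * T h x)) \<and>
     (\<exists>C. \<forall>h\<in>V. nrm (T h) \<le> C * nrm h)"

text \<open>The numbers \<open>z\<close> for which \<open>z - T\<close> has no two-sided inverse among the bounded operators
  on the space \<open>V\<close> normed by \<open>nrm\<close>.\<close>

definition op_spectrum ::
  "('a \<Rightarrow> complex) set \<Rightarrow> (('a \<Rightarrow> complex) \<Rightarrow> real) \<Rightarrow> (('a \<Rightarrow> complex) \<Rightarrow> 'a \<Rightarrow> complex) \<Rightarrow> complex set"
where
  "op_spectrum V nrm T =
     {z. \<not> (\<exists>R. bounded_operator_on V nrm R \<and>
               (\<forall>h\<in>V. R (\<lambda>x. z * h x - T h x) = h \<and>
                      (\<lambda>x. z * R h x - T (R h) x) = h))}"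

text \<open>The values of \<open>f\<close> at the partition points play no role beyond lying in \<open>[0,1]\<close>.\<close>

definition full_branch_expanding ::
  "nat \<Rightarrow> nat \<Rightarrow> (nat \<Rightarrow> real) \<Rightarrow> real \<Rightarrow> (real \<Rightarrow> real) \<Rightarrow> bool"
where
  "full_branch_expanding r N p lam f \<longleftrightarrow>
     f \<in> {0..1} \<rightarrow> {0..1} \<and>
     p 1 = 0 \<and> p (N + 1) = 1 \<and> strict_mono_on {1..N + 1} p \<and>
     (\<forall>i\<in>{1..N}. \<exists>g. (\<forall>x\<in>{p i<..<p (i + 1)}. g x = f x) \<and>
                      C_on r {p i..p (i + 1)} g \<and>
                      g ` {p i..p (i + 1)} = {0..1}) \<and>
     1 < lam \<and> (\<forall>i\<in>{1..N}. \<forall>x\<in>{p i<..<p (i + 1)}. lam < deriv f x)"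

text \<open>The continuous extension of the restriction of \<open>f\<close> to \<open>(p i, p (i + 1))\<close> to the closed
  interval.\<close>

definition branch :: "(nat \<Rightarrow> real) \<Rightarrow> (real \<Rightarrow> real) \<Rightarrow> nat \<Rightarrow> real \<Rightarrow> real" where
  "branch p f i x = Lim (at x within {p i<..<p (i + 1)}) f"

lemma branch_eq_extension:
  assumes "p i < p (i + 1)" and "x \<in> {p i..p (i + 1)}"
    and "\<And>y. y \<in> {p i<..<p (i + 1)} \<Longrightarrow> g y = f y"
    and "continuous_on {p i..p (i + 1)} g"
  shows "branch p f i x = g x"
proof -
  let ?I = "{p i<..<p (i + 1)}"
  have "(g \<longlongrightarrow> g x) (at x within {p i..p (i + 1)})"
    using assms(2,4) by (auto simp: continuous_on_def)
  then have "(g \<longlongrightarrow> g x) (at x within ?I)"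
    by (rule tendsto_within_subset) auto
  moreover have "\<forall>\<^sub>F y in at x within ?I. g y = f y"
    using assms(3) by (auto simp: eventually_at_filter)
  ultimately have "(f \<longlongrightarrow> g x) (at x within ?I)"
    by (simp cong: tendsto_cong)
  moreover have "x islimpt ?I"
    using assms(1,2) closure_greaterThanLessThan[OF assms(1)]
    by (cases "x \<in> ?I") (auto simp: closure_def intro: interior_limit_point)
  ultimately show ?thesis
    unfolding branch_def by (intro tendsto_Lim) (auto simp: trivial_limit_within)
qed

definition inv_branch :: "(nat \<Rightarrow> real) \<Rightarrow> (real \<Rightarrow> real) \<Rightarrow> nat \<Rightarrow> real \<Rightarrow> real" where
  "inv_branch p f i = inv_into {p i..p (i + 1)} (branch p f i)"

text \<open>The preimages are taken along the \<open>N\<close> extended branches, so that every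
  \<open>x \<in> [0,1]\<close> has exactly one preimage per branch, and the derivative at a preimage is that
  of the branch.\<close>

definition transfer_op ::
  "nat \<Rightarrow> (nat \<Rightarrow> real) \<Rightarrow> (real \<Rightarrow> real) \<Rightarrow> nat \<Rightarrow> (real \<Rightarrow> complex) \<Rightarrow> real \<Rightarrow> complex"
where
  "transfer_op N p f k h x =
     (if x \<in> {0..1} then
        \<Sum>i=1..N. let y = inv_branch p f i x in
          h y / of_real (vector_derivative (branch p f i) (at y within {p i..p (i + 1)}) ^ k)
      else 0)"

end

theory Submission
  imports Defs
begin

text \<open>
Write \<open>\<psi>\<^sub>1, \<dots>, \<psi>\<^sub>N\<close> for the inverse branches, so that \<open>L\<^sub>0 u = (\<Sum>i. u \<circ> \<psi>\<^sub>i)\<close> and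
\<open>L\<^sub>1 v = (\<Sum>i. \<psi>\<^sub>i' * (v \<circ> \<psi>\<^sub>i))\<close>. The chain rule gives \<open>(L\<^sub>0 u)' = L\<^sub>1 u'\<close>: differentiation
maps \<open>C\<^sup>m\<^sup>+\<^sup>1\<close> onto \<open>C\<^sup>m\<close>, intertwines \<open>L\<^sub>0\<close> with \<open>L\<^sub>1\<close>, and has the constants as kernel, on which
\<open>L\<^sub>0\<close> is multiplication by \<open>N\<close>. Hence the spectrum of \<open>L\<^sub>0\<close> on \<open>C\<^sup>m\<^sup>+\<^sup>1\<close> is that of \<open>L\<^sub>1\<close> on \<open>C\<^sup>m\<close>
together with \<open>N\<close>. This is \<open>spectrum_Suc\<close>: for \<open>z \<noteq> N\<close> a resolvent of one operator is turned into a
resolvent of the other by integrating or differentiating, and \<open>z - N\<close> can be divided by in order to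
adjust the constant of integration. The case \<open>m = 1\<close> is the second claim, an equality of full
spectra that is then intersected with \<open>\<bar>z\<bar> \<ge> \<lambda>\<^sup>-\<^sup>1\<close>.

For the first claim, \<open>m = 0\<close> reduces everything to the fact that the spectrum of \<open>L\<^sub>1\<close> on continuous
functions lies in the closed unit disc (\<open>spectrum_C_0\<close>). It suffices that the powers of \<open>L\<^sub>1\<close> are
uniformly bounded, and by positivity that the functions \<open>h\<^sub>n = L\<^sub>1\<^sup>n 1\<close> are. Bounded distortion of the
branches is inherited by \<open>h\<^sub>n\<close> with a constant independent of \<open>n\<close> (\<open>iter_density_distortion\<close>), so
\<open>h\<^sub>n\<close> is bounded by a constant multiple of any of its values. One of them equals \<open>1\<close>, because \<open>h\<^sub>n\<close>
is the derivative of \<open>L\<^sub>0\<^sup>n id\<close>, whose increment over \<open>[0,1]\<close> stays \<open>1\<close>: the branch images tile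
\<open>[0,1]\<close> and the increments telescope.
\<close>

section \<open>The spaces \<open>C\<^sup>m\<close> under differentiation\<close>

lemma iter_deriv_Suc:
  "iter_deriv S (Suc j) g = iter_deriv S j (\<lambda>x. vector_derivative g (at x within S))"
  unfolding iter_deriv_def by (simp add: funpow_Suc_right del: funpow.simps)

lemma vector_derivative_within_cong:
  assumes "\<And>x. x \<in> S \<Longrightarrow> g x = h x" "x \<in> S"
  shows "vector_derivative g (at x within S) = vector_derivative h (at x within S)"
  using assms by (intro vector_derivative_cong_eq) auto

lemma iter_deriv_cong:
  assumes "\<And>x. x \<in> S \<Longrightarrow> g x = h x" "x \<in> S"
  shows "iter_deriv S j g x = iter_deriv S j h x"
  using assms
proof (induction j arbitrary: x)
  case 0
  then show ?case by (simp add: iter_deriv_def)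
next
  case (Suc j)
  have "vector_derivative (iter_deriv S j g) (at x within S)
      = vector_derivative (iter_deriv S j h) (at x within S)"
    using Suc by (intro vector_derivative_within_cong) auto
  then show ?case by (simp add: iter_deriv_def)
qed

lemma C_on_cong:
  assumes "\<And>x. x \<in> S \<Longrightarrow> g x = h x"
  shows "C_on m S g \<longleftrightarrow> C_on m S h"
proof -
  have "iter_deriv S j g differentiable_on S \<longleftrightarrow> iter_deriv S j h differentiable_on S" for j
    unfolding differentiable_on_def
    using iter_deriv_cong[of S g h, OF assms] differentiable_transform_within[of _ _ S 1]
    by (metis zero_less_one)
  moreover have "continuous_on S (iter_deriv S m g) \<longleftrightarrow> continuous_on S (iter_deriv S m h)"
    by (rule continuous_on_cong[OF refl]) (rule iter_deriv_cong[OF assms])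
  ultimately show ?thesis by (simp add: C_on_def)
qed

lemma C_on_Suc:
  "C_on (Suc m) S g \<longleftrightarrow>
     g differentiable_on S \<and> C_on m S (\<lambda>x. vector_derivative g (at x within S))"
  unfolding C_on_def All_less_Suc2 iter_deriv_Suc by (auto simp: iter_deriv_def)

lemma C_on_imp_continuous_on: "C_on m S g \<Longrightarrow> continuous_on S g"
  by (cases m)
    (auto simp: C_on_Suc differentiable_imp_continuous_on, simp add: C_on_def iter_deriv_def)

text \<open>The derivative on \<open>[0,1]\<close> has to be extended by zero again in order to be an element of
  the spaces \<open>C_space\<close>; the same holds for the primitive.\<close>

definition slope :: "(real \<Rightarrow> complex) \<Rightarrow> real \<Rightarrow> complex" where
  "slope h x = (if x \<in> {0..1} then vector_derivative h (at x within {0..1}) else 0)"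

definition prim :: "(real \<Rightarrow> complex) \<Rightarrow> real \<Rightarrow> complex" where
  "prim w x = (if x \<in> {0..1} then integral {0..x} w else 0)"

lemma prim_outside: "x \<notin> {0..1} \<Longrightarrow> prim w x = 0"
  unfolding prim_def by (rule if_not_P)

lemma slope_eqI:
  "(h has_vector_derivative v) (at x within {0..1}) \<Longrightarrow> x \<in> {0..1} \<Longrightarrow> slope h x = v"
  by (simp add: slope_def vector_derivative_within_closed_interval)

lemma slope_eq_funI:
  assumes "\<And>x. x \<in> {0..1} \<Longrightarrow> (h has_vector_derivative v x) (at x within {0..1})"
    and "\<And>x. x \<notin> {0..1} \<Longrightarrow> v x = 0"
  shows "slope h = v"
proof
  show "slope h x = v x" for x
    using assms by (cases "x \<in> {0..1}") (auto intro: slope_eqI, auto simp: slope_def)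
qed

lemma C_space_outside: "h \<in> C_space m \<Longrightarrow> x \<notin> {0..1} \<Longrightarrow> h x = 0"
  by (auto simp: C_space_def)

lemma C_space_continuous: "h \<in> C_space m \<Longrightarrow> continuous_on {0..1} h"
  by (auto simp: C_space_def intro: C_on_imp_continuous_on)

lemma C_space_0_iff:
  "h \<in> C_space 0 \<longleftrightarrow> continuous_on {0..1} h \<and> (\<forall>x. x \<notin> {0..1} \<longrightarrow> h x = 0)"
  by (simp add: C_space_def C_on_def iter_deriv_def)

lemma C_space_subset_0: "h \<in> C_space m \<Longrightarrow> h \<in> C_space 0"
  using C_space_continuous C_space_outside by (auto simp: C_space_0_iff)

lemma C_on_slope: "C_on m {0..1} (slope h)
    \<longleftrightarrow> C_on m {0..1} (\<lambda>x. vector_derivative h (at x within {0..1}))"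
  by (rule C_on_cong) (simp add: slope_def)

lemma slope_in_C_space: "h \<in> C_space (Suc m) \<Longrightarrow> slope h \<in> C_space m"
  using C_on_slope[of m h] by (auto simp: C_space_def C_on_Suc slope_def)

lemma C_space_has_slope:
  assumes "h \<in> C_space (Suc m)" "x \<in> {0..1}"
  shows "(h has_vector_derivative slope h x) (at x within {0..1})"
  using assms
  by (auto simp: C_space_def C_on_Suc slope_def differentiable_on_def vector_derivative_works)

lemma C_space_SucI:
  assumes "\<And>x. x \<in> {0..1} \<Longrightarrow> (h has_vector_derivative v x) (at x within {0..1})"
    and "v \<in> C_space m" and "\<And>x. x \<notin> {0..1} \<Longrightarrow> h x = 0"
  shows "h \<in> C_space (Suc m)"
proof -
  have "slope h = v"
    using assms(1) C_space_outside[OF assms(2)] by (rule slope_eq_funI)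
  then show ?thesis
    using assms C_on_slope[of m h] differentiableI_vector[OF assms(1)]
    by (auto simp: C_space_def C_on_Suc differentiable_on_def)
qed

lemma zero_in_C_space: "(\<lambda>x. 0) \<in> C_space m"
proof (induction m)
  case 0
  then show ?case by (simp add: C_space_0_iff)
next
  case (Suc m)
  then show ?case by (intro C_space_SucI[where v = "\<lambda>x. 0"]) auto
qed

lemma constant_has_derivative:
  assumes "x \<in> {0..1}"
  shows "((\<lambda>x. if x \<in> {0..1} then c else 0 :: complex) has_vector_derivative 0)
           (at x within {0..1})"
  by (rule has_vector_derivative_transform[OF assms _ has_vector_derivative_const[of c]]) simp

lemma constant_in_C_space: "(\<lambda>x. if x \<in> {0..1} then c else 0) \<in> C_space m"
proof (cases m)
  case 0
  have "continuous_on {0..1::real} (\<lambda>x. if x \<in> {0..1} then c else 0)"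
    by (rule continuous_on_eq[where f = "\<lambda>x. c"]) auto
  then show ?thesis by (simp add: 0 C_space_0_iff)
next
  case (Suc m')
  show ?thesis unfolding Suc
    by (rule C_space_SucI[OF constant_has_derivative zero_in_C_space]) auto
qed

lemma prim_has_derivative:
  assumes "w \<in> C_space m" "x \<in> {0..1}"
  shows "(prim w has_vector_derivative w x) (at x within {0..1})"
  by (rule has_vector_derivative_transform[OF assms(2) _ integral_has_vector_derivative])
    (use assms C_space_continuous in \<open>auto simp: prim_def\<close>)

lemma prim_in_C_space: "w \<in> C_space m \<Longrightarrow> prim w \<in> C_space (Suc m)"
  by (rule C_space_SucI[OF prim_has_derivative]) (auto simp: prim_def)

lemma slope_prim: "w \<in> C_space m \<Longrightarrow> slope (prim w) = w"
  by (rule slope_eq_funI[OF prim_has_derivative]) (auto dest: C_space_outside)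

lemma prim_of_derivative:
  assumes "\<And>x. x \<in> {0..1} \<Longrightarrow> (h has_vector_derivative v x) (at x within {0..1})"
    and "x \<in> {0..1}"
  shows "prim v x = h x - h 0"
proof -
  have "(v has_integral h x - h 0) {0..x}"
    by (rule fundamental_theorem_of_calculus)
      (use assms in \<open>auto intro: has_vector_derivative_within_subset[where S = "{0..1}"]\<close>)
  then show ?thesis
    using assms(2) by (simp add: prim_def integral_unique)
qed

lemma prim_add:
  assumes "g \<in> C_space m" "h \<in> C_space m"
  shows "prim (\<lambda>x. g x + h x) = (\<lambda>x. prim g x + prim h x)"
proof -
  have "integral {0..x} (\<lambda>x. g x + h x) = integral {0..x} g + integral {0..x} h"
    if "x \<in> {0..1}" for x
    using that assms[THEN C_space_continuous]
    by (intro integral_add integrable_continuous_real)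
      (auto intro: continuous_on_subset)
  then show ?thesis by (auto simp: prim_def)
qed

lemma prim_mult: "prim (\<lambda>x. c * h x) = (\<lambda>x. c * prim h x)"
  by (auto simp: prim_def)

lemma slope_add:
  assumes "g \<in> C_space (Suc m)" "h \<in> C_space (Suc m)"
  shows "slope (\<lambda>x. g x + h x) = (\<lambda>x. slope g x + slope h x)"
  using assms[THEN C_space_has_slope]
  by (intro slope_eq_funI has_vector_derivative_add) (auto simp: slope_def)

lemma slope_mult:
  assumes "h \<in> C_space (Suc m)"
  shows "slope (\<lambda>x. c * h x) = (\<lambda>x. c * slope h x)"
  using C_space_has_slope[OF assms]
  by (intro slope_eq_funI has_vector_derivative_mult_right) (auto simp: slope_def)

lemma C_norm_0: "C_norm 0 h = (SUP x\<in>{0..1}. cmod (h x))"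
  by (simp add: C_norm_def iter_deriv_def)

lemma C_norm_Suc: "C_norm (Suc m) h = C_norm 0 h + C_norm m (slope h)"
proof -
  have "(\<Sum>j\<le>m. SUP x\<in>{0..1}. cmod (iter_deriv {0..1} (Suc j) h x)) = C_norm m (slope h)"
    unfolding C_norm_def iter_deriv_Suc
    by (intro sum.cong refl SUP_cong arg_cong[where f = cmod] iter_deriv_cong)
      (auto simp: slope_def)
  then show ?thesis
    by (simp add: C_norm_def sum.atMost_Suc_shift del: sum.atMost_Suc)
qed

lemma cmod_le_C_norm_0:
  assumes "h \<in> C_space m" "x \<in> {0..1}"
  shows "cmod (h x) \<le> C_norm 0 h"
proof -
  have "compact ((\<lambda>x. cmod (h x)) ` {0..1})"
    using C_space_continuous[OF assms(1)]
    by (intro compact_continuous_image continuous_intros) auto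
  then have "bdd_above ((\<lambda>x. cmod (h x)) ` {0..1})"
    by (intro bounded_imp_bdd_above compact_imp_bounded)
  then show ?thesis
    unfolding C_norm_0 using assms(2) by (rule cSUP_upper2[OF _ _ order_refl])
qed

lemma C_norm_0_le: "(\<And>x. x \<in> {0..1} \<Longrightarrow> cmod (h x) \<le> B) \<Longrightarrow> C_norm 0 h \<le> B"
  unfolding C_norm_0 by (rule cSUP_least) auto

lemma C_norm_nonneg: "h \<in> C_space m \<Longrightarrow> 0 \<le> C_norm m h"
proof (induction m arbitrary: h)
  case 0
  then show ?case using order_trans[OF norm_ge_zero cmod_le_C_norm_0[of h 0 0]] by simp
next
  case (Suc m)
  have "0 \<le> C_norm 0 h"
    using order_trans[OF norm_ge_zero cmod_le_C_norm_0[OF Suc.prems, of 0]] by simp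
  then show ?case using Suc.IH[OF slope_in_C_space[OF Suc.prems]] by (simp add: C_norm_Suc)
qed

lemma C_norm_0_le_C_norm: "h \<in> C_space m \<Longrightarrow> C_norm 0 h \<le> C_norm m h"
  by (cases m) (auto simp: C_norm_Suc dest: slope_in_C_space C_norm_nonneg)

lemma cmod_prim_le:
  assumes "w \<in> C_space m" "x \<in> {0..1}"
  shows "cmod (prim w x) \<le> C_norm 0 w"
proof -
  have "cmod (integral {0..x} w) \<le> C_norm 0 w * (x - 0)"
    using assms C_space_continuous[OF assms(1)] cmod_le_C_norm_0[OF assms(1)]
    by (intro integral_bound) (auto intro: continuous_on_subset)
  also have "\<dots> \<le> C_norm 0 w * 1"
    using assms C_norm_nonneg[OF C_space_subset_0[OF assms(1)]] by (intro mult_left_mono) auto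
  finally show ?thesis using assms(2) by (simp add: prim_def)
qed

section \<open>Differentiation intertwines the two transfer operators\<close>

text \<open>The operators see the map only through its inverse branches. These contract by \<open>q\<close>, their
  derivatives have distortion \<open>K\<close>, and their images \<open>[p i, p (Suc i)]\<close> tile the unit interval in
  increasing order.\<close>

locale inverse_branches =
  fixes N :: nat and p :: "nat \<Rightarrow> real" and \<psi> d\<psi> :: "nat \<Rightarrow> real \<Rightarrow> real" and q K :: real
  assumes maps_to: "i \<in> {1..N} \<Longrightarrow> x \<in> {0..1} \<Longrightarrow> \<psi> i x \<in> {0..1}"
    and branch_deriv: "i \<in> {1..N} \<Longrightarrow> x \<in> {0..1} \<Longrightarrow>
      (\<psi> i has_real_derivative d\<psi> i x) (at x within {0..1})"
    and deriv_continuous: "i \<in> {1..N} \<Longrightarrow> continuous_on {0..1} (d\<psi> i)"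
    and deriv_nonneg: "i \<in> {1..N} \<Longrightarrow> x \<in> {0..1} \<Longrightarrow> 0 \<le> d\<psi> i x"
    and deriv_le: "i \<in> {1..N} \<Longrightarrow> x \<in> {0..1} \<Longrightarrow> d\<psi> i x \<le> q"
    and contracting: "q < 1"
    and distortion: "i \<in> {1..N} \<Longrightarrow> x \<in> {0..1} \<Longrightarrow> y \<in> {0..1} \<Longrightarrow>
      d\<psi> i x \<le> exp (K * \<bar>x - y\<bar>) * d\<psi> i y"
    and left_end: "i \<in> {1..N} \<Longrightarrow> \<psi> i 0 = p i"
    and right_end: "i \<in> {1..N} \<Longrightarrow> \<psi> i 1 = p (Suc i)"
    and outer_ends: "p 1 = 0" "p (Suc N) = 1"
begin

definition L :: "nat \<Rightarrow> (real \<Rightarrow> complex) \<Rightarrow> real \<Rightarrow> complex" where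
  "L k h x =
     (if x \<in> {0..1} then \<Sum>i=1..N. of_real (d\<psi> i x ^ k) * h (\<psi> i x) else 0)"

lemma L_outside: "x \<notin> {0..1} \<Longrightarrow> L k h x = 0"
  unfolding L_def by (rule if_not_P)

lemma L_inside:
  "x \<in> {0..1} \<Longrightarrow> L k h x = (\<Sum>i=1..N. of_real (d\<psi> i x ^ k) * h (\<psi> i x))"
  unfolding L_def by (rule if_P)

lemma L_cong:
  assumes "\<And>x. x \<in> {0..1} \<Longrightarrow> g x = h x"
  shows "L k g = L k h"
  using assms maps_to unfolding L_def by (intro ext if_cong sum.cong refl) simp

lemma L_add: "L k (\<lambda>x. g x + h x) = (\<lambda>x. L k g x + L k h x)"
  by (auto simp: L_def sum.distrib algebra_simps)

lemma L_mult: "L k (\<lambda>x. c * h x) = (\<lambda>x. c * L k h x)"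
  by (auto simp: L_def sum_distrib_left algebra_simps)

lemma L_0_constant:
  "x \<in> {0..1} \<Longrightarrow> L 0 (\<lambda>x. if x \<in> {0..1} then c else 0) x = of_nat N * c"
  using maps_to by (simp add: L_def)

lemma L_0_has_derivative:
  assumes "\<And>x. x \<in> {0..1} \<Longrightarrow> (u has_vector_derivative v x) (at x within {0..1})"
    and "x \<in> {0..1}"
  shows "(L 0 u has_vector_derivative L 1 v x) (at x within {0..1})"
proof -
  have "((u \<circ> \<psi> i) has_vector_derivative d\<psi> i x *\<^sub>R v (\<psi> i x)) (at x within {0..1})"
    if "i \<in> {1..N}" for i
  proof (rule vector_diff_chain_within)
    show "(\<psi> i has_vector_derivative d\<psi> i x) (at x within {0..1})"
      using branch_deriv[OF that assms(2)] by (simp add: has_real_derivative_iff_has_vector_derivative)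
    have "\<psi> i ` {0..1} \<subseteq> {0..1}"
      using maps_to that by auto
    then show "(u has_vector_derivative v (\<psi> i x)) (at (\<psi> i x) within \<psi> i ` {0..1})"
      using assms maps_to[OF that] by (blast intro: has_vector_derivative_within_subset)
  qed
  then have "((\<lambda>x. \<Sum>i=1..N. u (\<psi> i x)) has_vector_derivative
      (\<Sum>i=1..N. d\<psi> i x *\<^sub>R v (\<psi> i x))) (at x within {0..1})"
    by (intro has_vector_derivative_sum) (simp add: o_def)
  then have "((\<lambda>x. \<Sum>i=1..N. u (\<psi> i x)) has_vector_derivative L 1 v x) (at x within {0..1})"
    using assms(2) by (simp add: L_def scaleR_conv_of_real)
  then show ?thesis
    by (rule has_vector_derivative_transform[OF assms(2), rotated]) (simp add: L_def)
qed

lemma resolvent_has_derivative: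
  assumes "\<And>x. x \<in> {0..1} \<Longrightarrow> (u has_vector_derivative v x) (at x within {0..1})"
    and "x \<in> {0..1}"
  shows "((\<lambda>x. z * u x - L 0 u x) has_vector_derivative z * v x - L 1 v x) (at x within {0..1})"
  using assms L_0_has_derivative[OF assms]
  by (intro has_vector_derivative_diff has_vector_derivative_mult_right) auto

lemma cmod_L_0_le:
  assumes "\<And>x. x \<in> {0..1} \<Longrightarrow> cmod (u x) \<le> B" "x \<in> {0..1}"
  shows "cmod (L 0 u x) \<le> of_nat N * B"
proof -
  have "cmod (\<Sum>i=1..N. u (\<psi> i x)) \<le> of_nat (card {1..N}) * B"
    using assms maps_to by (intro sum_norm_bound) blast
  then show ?thesis using assms(2) by (simp add: L_def)
qed

section \<open>Transporting resolvents between \<open>C\<^sup>m\<close> and \<open>C\<^sup>m\<^sup>+\<^sup>1\<close>\<close>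

text \<open>Integrating the resolvent of the derivative-weighted operator inverts the unweighted
  operator up to an additive constant. Since constants are multiplied by \<open>z - N\<close>, the constant can be
  corrected, in exactly one way, whenever \<open>z \<noteq> N\<close>.\<close>

lemma resolvent_by_integration:
  assumes z: "z \<noteq> of_nat N"
    and "z \<notin> op_spectrum (C_space m) (C_norm m) (L 1)"
  shows "z \<notin> op_spectrum (C_space (Suc m)) (C_norm (Suc m)) (L 0)"
proof -
  obtain R where R: "bounded_operator_on (C_space m) (C_norm m) R"
    and left: "\<And>h. h \<in> C_space m \<Longrightarrow> R (\<lambda>x. z * h x - L 1 h x) = h"
    and right: "\<And>h. h \<in> C_space m \<Longrightarrow> (\<lambda>x. z * R h x - L 1 (R h) x) = h"
    using assms(2) unfolding op_spectrum_def by blast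
  from R have R_in: "\<And>h. h \<in> C_space m \<Longrightarrow> R h \<in> C_space m"
    and R_add: "\<And>g h. g \<in> C_space m \<Longrightarrow> h \<in> C_space m \<Longrightarrow>
      R (\<lambda>x. g x + h x) = (\<lambda>x. R g x + R h x)"
    and R_mult: "\<And>c h. h \<in> C_space m \<Longrightarrow> R (\<lambda>x. c * h x) = (\<lambda>x. c * R h x)"
    unfolding bounded_operator_on_def by auto
  from R obtain C0 where C0: "\<And>h. h \<in> C_space m \<Longrightarrow> C_norm m (R h) \<le> C0 * C_norm m h"
    unfolding bounded_operator_on_def by blast
  define C where "C = max 0 C0"
  have C: "C_norm m (R h) \<le> C * C_norm m h" if "h \<in> C_space m" for h
    using C0[OF that] C_norm_nonneg[OF that] mult_right_mono[of C0 C "C_norm m h"]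
    by (simp add: C_def)
  define U where "U h = prim (R (slope h))" for h
  \<comment> \<open>The only constant for which \<open>z u - L 0 u\<close> and \<open>h\<close> agree at \<open>0\<close>, where \<open>U h\<close> vanishes.\<close>
  define c where "c h = (h 0 + L 0 (U h) 0) / (z - of_nat N)" for h
  define S where "S h x = U h x + (if x \<in> {0..1} then c h else 0)" for h x
  have zN: "z - of_nat N \<noteq> 0" using z by simp
  have S_outside: "S h x = 0" if "x \<notin> {0..1}" for h x
    unfolding S_def U_def using that by (simp only: prim_outside if_False not_False_eq_True add_0_right)
  have U_deriv: "(U h has_vector_derivative R (slope h) x) (at x within {0..1})"
    if "h \<in> C_space (Suc m)" "x \<in> {0..1}" for h x
    unfolding U_def using that by (intro prim_has_derivative[where m = m] R_in slope_in_C_space)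
  have S_deriv: "(S h has_vector_derivative R (slope h) x) (at x within {0..1})"
    if "h \<in> C_space (Suc m)" "x \<in> {0..1}" for h x
    using has_vector_derivative_add[OF U_deriv[OF that] constant_has_derivative[OF that(2)]]
    unfolding S_def[abs_def] by simp
  have S_in: "S h \<in> C_space (Suc m)" if "h \<in> C_space (Suc m)" for h
    using that S_outside
    by (intro C_space_SucI[OF S_deriv] R_in slope_in_C_space) auto
  have slope_S: "slope (S h) = R (slope h)" if "h \<in> C_space (Suc m)" for h
    by (rule slope_eq_funI[OF S_deriv[OF that]])
      (auto intro: C_space_outside[OF R_in[OF slope_in_C_space[OF that]]])
  have L_S: "L 0 (S h) = (\<lambda>x. L 0 (U h) x + (if x \<in> {0..1} then of_nat N * c h else 0))" for h
    unfolding S_def[abs_def] L_add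
    using L_0_constant L_outside by auto
  have U_0: "U h 0 = 0" for h
    by (simp add: U_def prim_def)

  have right_inverse: "(\<lambda>x. z * S h x - L 0 (S h) x) = h" if h: "h \<in> C_space (Suc m)" for h
  proof
    fix x
    show "z * S h x - L 0 (S h) x = h x"
    proof (cases "x \<in> {0..1}")
      case False
      then show ?thesis using S_outside L_outside C_space_outside[OF h] by simp
    next
      case True
      let ?E = "\<lambda>x. z * S h x - L 0 (S h) x - h x"
      have deriv: "(?E has_vector_derivative 0) (at y within {0..1})" if "y \<in> {0..1}" for y
        using has_vector_derivative_diff[OF
            resolvent_has_derivative[OF S_deriv[OF h] that, where z = z] C_space_has_slope[OF h that]]
          fun_cong[OF right[OF slope_in_C_space[OF h]], of y] by simp
      have "?E x = ?E 0"
      proof (rule has_vector_derivative_zero_constant[OF convex_real_interval(5) deriv])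
        fix k assume "\<And>y. y \<in> {0..1} \<Longrightarrow> ?E y = k"
        from this[OF True] this[of 0] show "?E x = ?E 0" by simp
      qed
      also have "\<dots> = (z - of_nat N) * c h - L 0 (U h) 0 - h 0"
        by (simp add: L_S S_def U_0 algebra_simps)
      also have "\<dots> = 0"
        using zN by (simp add: c_def)
      finally show ?thesis by simp
    qed
  qed

  have left_inverse: "S (\<lambda>x. z * h x - L 0 h x) = h" if h: "h \<in> C_space (Suc m)" for h
  proof
    fix x
    let ?g = "\<lambda>x. z * h x - L 0 h x"
    have "slope ?g = (\<lambda>x. z * slope h x - L 1 (slope h) x)"
      by (rule slope_eq_funI[OF resolvent_has_derivative[OF C_space_has_slope[OF h]]])
        (auto simp: slope_def L_outside)
    then have U: "U ?g = prim (slope h)"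
      using left[OF slope_in_C_space[OF h]] by (simp add: U_def)
    have U_eq: "U ?g y = h y - h 0" if "y \<in> {0..1}" for y
      unfolding U by (rule prim_of_derivative[OF C_space_has_slope[OF h] that])
    have "L 0 h 0 = L 0 (\<lambda>y. U ?g y + (if y \<in> {0..1} then h 0 else 0)) 0"
      by (rule fun_cong, rule L_cong) (simp add: U_eq)
    then have "L 0 h 0 = L 0 (U ?g) 0 + of_nat N * h 0"
      using L_0_constant[of 0 "h 0"] by (simp add: L_add)
    then have "c ?g = ((z - of_nat N) * h 0) / (z - of_nat N)"
      by (simp add: c_def algebra_simps)
    then have "c ?g = h 0"
      using zN by simp
    then show "S ?g x = h x"
      using U_eq[of x] S_outside[of x ?g] C_space_outside[OF h, of x]
      by (cases "x \<in> {0..1}") (auto simp: S_def)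
  qed

  have S_add: "S (\<lambda>x. g x + h x) = (\<lambda>x. S g x + S h x)"
    if "g \<in> C_space (Suc m)" "h \<in> C_space (Suc m)" for g h
  proof -
    have "U (\<lambda>x. g x + h x) = (\<lambda>x. U g x + U h x)"
      unfolding U_def using that[THEN slope_in_C_space] R_in
      by (simp add: slope_add[OF that] R_add prim_add[where m = m])
    then have "c (\<lambda>x. g x + h x) = c g + c h"
      unfolding c_def by (simp add: L_add add_divide_distrib)
    then show ?thesis
      using \<open>U (\<lambda>x. g x + h x) = (\<lambda>x. U g x + U h x)\<close> by (auto simp: S_def)
  qed
  have S_mult: "S (\<lambda>x. a * h x) = (\<lambda>x. a * S h x)" if "h \<in> C_space (Suc m)" for a h
  proof -
    have "U (\<lambda>x. a * h x) = (\<lambda>x. a * U h x)"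
      unfolding U_def using slope_in_C_space[OF that] R_in
      by (simp add: slope_mult[OF that] R_mult prim_mult)
    then have "c (\<lambda>x. a * h x) = a * c h"
      unfolding c_def by (simp add: L_mult algebra_simps)
    then show ?thesis
      using \<open>U (\<lambda>x. a * h x) = (\<lambda>x. a * U h x)\<close> by (auto simp: S_def algebra_simps)
  qed

  define D where "D = cmod (z - of_nat N)"
  have D: "D > 0" using zN by (simp add: D_def)
  have S_bound: "C_norm (Suc m) (S h) \<le> ((1 + of_nat N * C) / D + C + C) * C_norm (Suc m) h"
    if h: "h \<in> C_space (Suc m)" for h
  proof -
    let ?H = "C_norm (Suc m) h"
    note sl = slope_in_C_space[OF h]
    have nonneg: "0 \<le> C_norm 0 h" "0 \<le> C_norm m (slope h)"
      using C_norm_nonneg[OF C_space_subset_0[OF h]] C_norm_nonneg[OF sl] by auto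
    have H: "C_norm 0 h \<le> ?H" "C_norm m (slope h) \<le> ?H" "0 \<le> ?H"
      using nonneg by (auto simp: C_norm_Suc)
    have RH: "C_norm m (R (slope h)) \<le> C * ?H"
      using C[OF sl] mult_left_mono[OF H(2), of C] by (simp add: C_def)
    have U: "cmod (U h x) \<le> C * ?H" if "x \<in> {0..1}" for x
      unfolding U_def using cmod_prim_le[OF R_in[OF sl] that] C_norm_0_le_C_norm[OF R_in[OF sl]] RH
      by simp
    have "cmod (c h) = cmod (h 0 + L 0 (U h) 0) / D"
      by (simp add: c_def D_def norm_divide)
    also have "\<dots> \<le> (?H + of_nat N * (C * ?H)) / D"
    proof (intro divide_right_mono norm_triangle_le add_mono)
      show "cmod (h 0) \<le> ?H"
        using cmod_le_C_norm_0[OF h, of 0] H(1) by simp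
      show "cmod (L 0 (U h) 0) \<le> of_nat N * (C * ?H)"
        by (rule cmod_L_0_le[OF U]) auto
    qed (use D in simp)
    finally have c_le: "cmod (c h) \<le> (1 + of_nat N * C) / D * ?H"
      by (simp add: algebra_simps)
    have "C_norm 0 (S h) \<le> C * ?H + (1 + of_nat N * C) / D * ?H"
      using U c_le by (intro C_norm_0_le) (auto simp: S_def intro!: norm_triangle_le add_mono)
    then show ?thesis
      using RH by (simp add: C_norm_Suc[of m "S h"] slope_S[OF h] algebra_simps)
  qed

  have "bounded_operator_on (C_space (Suc m)) (C_norm (Suc m)) S"
    unfolding bounded_operator_on_def using S_in S_add S_mult S_bound by blast
  then show ?thesis
    unfolding op_spectrum_def using left_inverse right_inverse by blast
qed

text \<open>Conversely, differentiating the resolvent of the unweighted operator gives one for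
  the derivative-weighted operator. To see that it is a left inverse, one has to recognise the primitive of
  \<open>z w - L 1 w\<close> as \<open>z - L 0\<close> applied to a primitive of \<open>w\<close>; again this needs the right
  additive constant, hence \<open>z \<noteq> N\<close>.\<close>

lemma resolvent_by_differentiation:
  assumes z: "z \<noteq> of_nat N"
    and "z \<notin> op_spectrum (C_space (Suc m)) (C_norm (Suc m)) (L 0)"
  shows "z \<notin> op_spectrum (C_space m) (C_norm m) (L 1)"
proof -
  obtain S where S: "bounded_operator_on (C_space (Suc m)) (C_norm (Suc m)) S"
    and left: "\<And>h. h \<in> C_space (Suc m) \<Longrightarrow> S (\<lambda>x. z * h x - L 0 h x) = h"
    and right: "\<And>h. h \<in> C_space (Suc m) \<Longrightarrow> (\<lambda>x. z * S h x - L 0 (S h) x) = h"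
    using assms(2) unfolding op_spectrum_def by blast
  from S have S_in: "\<And>h. h \<in> C_space (Suc m) \<Longrightarrow> S h \<in> C_space (Suc m)"
    and S_add: "\<And>g h. g \<in> C_space (Suc m) \<Longrightarrow> h \<in> C_space (Suc m) \<Longrightarrow>
      S (\<lambda>x. g x + h x) = (\<lambda>x. S g x + S h x)"
    and S_mult: "\<And>c h. h \<in> C_space (Suc m) \<Longrightarrow> S (\<lambda>x. c * h x) = (\<lambda>x. c * S h x)"
    unfolding bounded_operator_on_def by auto
  from S obtain C0 where C0: "\<And>h. h \<in> C_space (Suc m) \<Longrightarrow>
      C_norm (Suc m) (S h) \<le> C0 * C_norm (Suc m) h"
    unfolding bounded_operator_on_def by blast
  define C where "C = max 0 C0"
  have C: "C_norm (Suc m) (S h) \<le> C * C_norm (Suc m) h" if "h \<in> C_space (Suc m)" for h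
    using C0[OF that] C_norm_nonneg[OF that] mult_right_mono[of C0 C "C_norm (Suc m) h"]
    by (simp add: C_def)
  define R where "R w = slope (S (prim w))" for w

  have R_in: "R w \<in> C_space m" if "w \<in> C_space m" for w
    unfolding R_def using that by (intro slope_in_C_space S_in prim_in_C_space)

  have right_inverse: "(\<lambda>x. z * R w x - L 1 (R w) x) = w" if w: "w \<in> C_space m" for w
  proof -
    have "slope (\<lambda>x. z * S (prim w) x - L 0 (S (prim w)) x)
        = (\<lambda>x. z * R w x - L 1 (R w) x)"
      unfolding R_def
      by (rule slope_eq_funI[OF
            resolvent_has_derivative[OF C_space_has_slope[OF S_in[OF prim_in_C_space[OF w]]]]])
        (auto simp: slope_def L_outside)
    then show ?thesis
      using right[OF prim_in_C_space[OF w]] slope_prim[OF w] by simp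
  qed

  have left_inverse: "R (\<lambda>x. z * w x - L 1 w x) = w" if w: "w \<in> C_space m" for w
  proof -
    let ?g = "\<lambda>x. z * prim w x - L 0 (prim w) x"
    \<comment> \<open>Chosen so that \<open>z W - L 0 W\<close> vanishes at \<open>0\<close>, as a primitive formed by \<open>prim\<close> must.\<close>
    define k where "k = L 0 (prim w) 0 / (z - of_nat N)"
    define W where "W x = prim w x + (if x \<in> {0..1} then k else 0)" for x
    have "(z - of_nat N) * k = L 0 (prim w) 0"
      using z by (simp add: k_def)
    then have k: "z * k - of_nat N * k = L 0 (prim w) 0"
      by (simp only: left_diff_distrib)
    have W_deriv: "(W has_vector_derivative w x) (at x within {0..1})" if "x \<in> {0..1}" for x
      using has_vector_derivative_add[OF prim_has_derivative[OF w that]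
          constant_has_derivative[OF that]]
      unfolding W_def[abs_def] by simp
    have W_in: "W \<in> C_space (Suc m)"
      by (rule C_space_SucI[OF W_deriv w]) (auto simp: W_def prim_def)
    have "prim (\<lambda>x. z * w x - L 1 w x) = (\<lambda>x. z * W x - L 0 W x)"
    proof
      fix x
      show "prim (\<lambda>x. z * w x - L 1 w x) x = z * W x - L 0 W x"
      proof (cases "x \<in> {0..1}")
        case True
        have "prim (\<lambda>x. z * w x - L 1 w x) x = ?g x - ?g 0"
          by (rule prim_of_derivative[OF resolvent_has_derivative[OF prim_has_derivative[OF w]] True])
        also have "\<dots> = ?g x + (z * k - of_nat N * k)"
          unfolding k by (simp add: prim_def)
        also have "\<dots> = z * W x - L 0 W x"
          unfolding W_def[abs_def] L_add using True L_0_constant[OF True, of k]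
          by (simp add: algebra_simps)
        finally show ?thesis .
      next
        case False
        then have "W x = 0"
          unfolding W_def by (simp only: prim_outside if_False not_False_eq_True add_0_right)
        then show ?thesis
          using False by (simp only: prim_outside L_outside not_False_eq_True) simp
      qed
    qed
    then have "R (\<lambda>x. z * w x - L 1 w x) = slope W"
      using left[OF W_in] by (simp add: R_def)
    also have "slope W = w"
      by (rule slope_eq_funI[OF W_deriv C_space_outside[OF w]])
    finally show ?thesis .
  qed

  have R_add: "R (\<lambda>x. g x + h x) = (\<lambda>x. R g x + R h x)"
    if "g \<in> C_space m" "h \<in> C_space m" for g h
    unfolding R_def using that[THEN prim_in_C_space] S_in
    by (simp add: prim_add[OF that] S_add slope_add[where m = m])
  have R_mult: "R (\<lambda>x. c * h x) = (\<lambda>x. c * R h x)" if "h \<in> C_space m" for c h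
    unfolding R_def using prim_in_C_space[OF that] S_in
    by (simp add: prim_mult S_mult slope_mult[where m = m])
  have R_bound: "C_norm m (R w) \<le> (2 * C) * C_norm m w" if w: "w \<in> C_space m" for w
  proof -
    note pr = prim_in_C_space[OF w]
    have "C_norm m (R w) \<le> C_norm (Suc m) (S (prim w))"
      using C_norm_nonneg[OF C_space_subset_0[OF S_in[OF pr]]] by (simp add: C_norm_Suc R_def)
    also have "\<dots> \<le> C * C_norm (Suc m) (prim w)"
      by (rule C[OF pr])
    also have "\<dots> \<le> C * (2 * C_norm m w)"
    proof (rule mult_left_mono)
      have "C_norm 0 (prim w) \<le> C_norm m w"
        using cmod_prim_le[OF w] C_norm_0_le_C_norm[OF w]
        by (intro C_norm_0_le) (blast intro: order_trans)
      then show "C_norm (Suc m) (prim w) \<le> 2 * C_norm m w"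
        by (simp add: C_norm_Suc slope_prim[OF w])
    qed (simp add: C_def)
    finally show ?thesis by simp
  qed

  have "bounded_operator_on (C_space m) (C_norm m) R"
    unfolding bounded_operator_on_def using R_in R_add R_mult R_bound by blast
  then show ?thesis
    unfolding op_spectrum_def using left_inverse right_inverse by blast
qed

text \<open>The constant function \<open>1\<close> is an eigenfunction.\<close>

lemma branch_number_in_spectrum: "of_nat N \<in> op_spectrum (C_space m) (C_norm m) (L 0)"
proof (rule ccontr)
  assume "\<not> ?thesis"
  then obtain R where R: "\<And>h. h \<in> C_space m \<Longrightarrow> R (\<lambda>x. of_nat N * h x - L 0 h x) = h"
    unfolding op_spectrum_def by blast
  let ?e = "\<lambda>x::real. if x \<in> {0..1} then 1 else 0 :: complex"
  have "(\<lambda>x. of_nat N * ?e x - L 0 ?e x) = (\<lambda>x. 0)"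
    using L_0_constant[where c = 1] L_outside by auto
  moreover have "(\<lambda>x. of_nat N * 0 - L 0 (\<lambda>x. 0) x) = (\<lambda>x. 0)"
    by (auto simp: L_def)
  ultimately have "?e = (\<lambda>x. 0)"
    using R[OF constant_in_C_space[of 1 m]] R[OF zero_in_C_space[of m]] by simp
  then show False
    by (metis (mono_tags) atLeastAtMost_iff order_refl zero_le_one zero_neq_one)
qed

theorem spectrum_Suc:
  "op_spectrum (C_space (Suc m)) (C_norm (Suc m)) (L 0)
     = insert (of_nat N) (op_spectrum (C_space m) (C_norm m) (L 1))"
proof (rule set_eqI)
  fix z
  show "z \<in> op_spectrum (C_space (Suc m)) (C_norm (Suc m)) (L 0)
      \<longleftrightarrow> z \<in> insert (of_nat N) (op_spectrum (C_space m) (C_norm m) (L 1))"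
    using resolvent_by_integration[of z m] resolvent_by_differentiation[of z m]
      branch_number_in_spectrum[of "Suc m"]
    by (cases "z = of_nat N") auto
qed

section \<open>Bounded distortion and the spectrum on continuous functions\<close>

text \<open>The \<open>n\<close>-th power of the derivative-weighted operator applied to the constant \<open>1\<close>, and of the
  unweighted operator applied to the identity, as real functions: one is the density, the other a
  distribution function of the same probability measure.\<close>

fun iter_density :: "nat \<Rightarrow> real \<Rightarrow> real" where
  "iter_density 0 x = 1"
| "iter_density (Suc n) x = (\<Sum>i=1..N. d\<psi> i x * iter_density n (\<psi> i x))"

fun iter_distrib :: "nat \<Rightarrow> real \<Rightarrow> real" where
  "iter_distrib 0 x = x"
| "iter_distrib (Suc n) x = (\<Sum>i=1..N. iter_distrib n (\<psi> i x))"

lemma iter_distrib_has_derivative: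
  "x \<in> {0..1} \<Longrightarrow> (iter_distrib n has_real_derivative iter_density n x) (at x within {0..1})"
proof (induction n arbitrary: x)
  case 0
  have "iter_distrib 0 = (\<lambda>x. x)" by auto
  then show ?case by (auto intro: derivative_eq_intros)
next
  case (Suc n)
  have "((iter_distrib n \<circ> \<psi> i) has_real_derivative iter_density n (\<psi> i x) * d\<psi> i x)
      (at x within {0..1})" if "i \<in> {1..N}" for i
  proof (rule DERIV_image_chain)
    have "\<psi> i ` {0..1} \<subseteq> {0..1}"
      using maps_to that by auto
    then show "(iter_distrib n has_real_derivative iter_density n (\<psi> i x))
        (at (\<psi> i x) within \<psi> i ` {0..1})"
      using Suc maps_to[OF that] by (blast intro: DERIV_subset)
  qed (rule branch_deriv[OF that Suc.prems])
  then have "((\<lambda>x. \<Sum>i=1..N. iter_distrib n (\<psi> i x)) has_real_derivative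
      (\<Sum>i=1..N. iter_density n (\<psi> i x) * d\<psi> i x)) (at x within {0..1})"
    by (intro DERIV_sum) (simp add: o_def)
  moreover have "iter_distrib (Suc n) = (\<lambda>x. \<Sum>i=1..N. iter_distrib n (\<psi> i x))"
    by auto
  ultimately show ?case by (simp add: mult.commute)
qed

text \<open>The increments over the branch images \<open>[p i, p (Suc i)]\<close> add up to the increment
  over their union \<open>[0,1]\<close>.\<close>

lemma iter_distrib_increment: "iter_distrib n 1 - iter_distrib n 0 = 1"
proof (induction n)
  case 0
  then show ?case by simp
next
  case (Suc n)
  have "iter_distrib (Suc n) 1 - iter_distrib (Suc n) 0
      = (\<Sum>i=1..N. iter_distrib n (p (Suc i)) - iter_distrib n (p i))"
    using left_end right_end by (simp add: sum_subtractf)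
  also have "\<dots> = iter_distrib n (p (Suc N)) - iter_distrib n (p 1)"
    by (rule sum_Suc_diff) simp
  finally show ?case using Suc outer_ends by simp
qed

lemma iter_density_nonneg: "x \<in> {0..1} \<Longrightarrow> 0 \<le> iter_density n x"
proof (induction n arbitrary: x)
  case (Suc n)
  then show ?case
    unfolding iter_density.simps
    by (intro sum_nonneg mult_nonneg_nonneg deriv_nonneg Suc.IH maps_to)
qed simp

lemma branch_contracts:
  assumes "i \<in> {1..N}" "x \<in> {0..1}" "y \<in> {0..1}"
  shows "\<bar>\<psi> i x - \<psi> i y\<bar> \<le> q * \<bar>x - y\<bar>"
  using field_differentiable_bound[of "{0..1}" "\<psi> i" "d\<psi> i" q x y] assms
    branch_deriv[OF assms(1)] deriv_nonneg[OF assms(1)] deriv_le[OF assms(1)]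
  by simp

text \<open>One application of the transfer operator adds the distortion \<open>K\<close> of a single branch, while
  the contraction multiplies the distortion already present by \<open>q\<close>; \<open>K / (1 - q)\<close> is the fixed point of
  \<open>a \<mapsto> K + q a\<close>.\<close>

lemma iter_density_distortion:
  assumes "0 \<le> K" "x \<in> {0..1}" "y \<in> {0..1}"
  shows "iter_density n x \<le> exp (K / (1 - q) * \<bar>x - y\<bar>) * iter_density n y"
  using assms(2,3)
proof (induction n arbitrary: x y)
  case 0
  then show ?case using \<open>0 \<le> K\<close> contracting by simp
next
  case (Suc n)
  define a where "a = K / (1 - q)"
  have a: "a \<ge> 0" "K + a * q = a"
    using \<open>0 \<le> K\<close> contracting by (auto simp: a_def field_simps)
  have "d\<psi> i x * iter_density n (\<psi> i x) \<le> exp (a * \<bar>x - y\<bar>) * (d\<psi> i y * iter_density n (\<psi> i y))"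
    if i: "i \<in> {1..N}" for i
  proof -
    have "iter_density n (\<psi> i x) \<le> exp (a * \<bar>\<psi> i x - \<psi> i y\<bar>) * iter_density n (\<psi> i y)"
      unfolding a_def using Suc maps_to[OF i] by blast
    also have "\<dots> \<le> exp (a * (q * \<bar>x - y\<bar>)) * iter_density n (\<psi> i y)"
      using branch_contracts[OF i Suc.prems] a(1) iter_density_nonneg[OF maps_to[OF i Suc.prems(2)]]
      by (intro mult_right_mono) (simp_all add: mult_left_mono)
    finally have "d\<psi> i x * iter_density n (\<psi> i x)
        \<le> (exp (K * \<bar>x - y\<bar>) * d\<psi> i y) * (exp (a * (q * \<bar>x - y\<bar>)) * iter_density n (\<psi> i y))"
      using distortion[OF i Suc.prems] deriv_nonneg[OF i] iter_density_nonneg maps_to[OF i] Suc.prems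
      by (intro mult_mono mult_nonneg_nonneg) auto
    also have "\<dots> = exp (K * \<bar>x - y\<bar> + a * (q * \<bar>x - y\<bar>)) * (d\<psi> i y * iter_density n (\<psi> i y))"
      by (simp add: exp_add)
    also have "K * \<bar>x - y\<bar> + a * (q * \<bar>x - y\<bar>) = (K + a * q) * \<bar>x - y\<bar>"
      by (simp add: algebra_simps)
    finally show ?thesis unfolding a(2) .
  qed
  then show ?case
    unfolding a_def[symmetric] iter_density.simps sum_distrib_left by (rule sum_mono)
qed

text \<open>By the mean value theorem the density takes its mean value \<open>1\<close> somewhere, and the distortion
  bound carries this to every other point.\<close>

lemma iter_density_le:
  assumes "0 \<le> K" "x \<in> {0..1}"
  shows "iter_density n x \<le> exp (K / (1 - q))"
proof -
  have "\<exists>y\<in>{0<..<1}. iter_distrib n 1 - iter_distrib n 0 = (1 - 0) * iter_density n y"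
  proof -
    have "\<exists>y\<in>{0<..<1}. iter_distrib n 1 - iter_distrib n 0 = (\<lambda>h. iter_density n y * h) (1 - 0)"
      using iter_distrib_has_derivative
      by (intro mvt_simple) (auto simp: has_field_derivative_def)
    then show ?thesis by simp
  qed
  then obtain y where "y \<in> {0<..<1}" "iter_density n y = 1"
    using iter_distrib_increment[of n] by auto
  then have y: "y \<in> {0..1}" "iter_density n y = 1"
    by auto
  have "iter_density n x \<le> exp (K / (1 - q) * \<bar>x - y\<bar>)"
    using iter_density_distortion[OF assms(1,2) y(1), of n] y(2) by simp
  also have "\<dots> \<le> exp (K / (1 - q))"
    using assms y(1) contracting
    by (simp only: exp_le_cancel_iff, intro mult_left_le) auto
  finally show ?thesis .
qed

text \<open>Since the weights are nonnegative, the triangle inequality passes through the operator, and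
  the constant function \<open>1\<close> majorises all functions of supremum norm at most \<open>1\<close>.\<close>

lemma L_power_le:
  assumes "\<And>x. x \<in> {0..1} \<Longrightarrow> cmod (h x) \<le> B" "x \<in> {0..1}"
  shows "cmod ((L 1 ^^ n) h x) \<le> B * iter_density n x"
  using assms(2)
proof (induction n arbitrary: x)
  case 0
  then show ?case using assms(1) by simp
next
  case (Suc n)
  have "cmod (of_real (d\<psi> i x) * (L 1 ^^ n) h (\<psi> i x)) \<le> B * (d\<psi> i x * iter_density n (\<psi> i x))"
    if i: "i \<in> {1..N}" for i
    using mult_left_mono[OF Suc.IH[OF maps_to[OF i Suc.prems]] deriv_nonneg[OF i Suc.prems]]
      deriv_nonneg[OF i Suc.prems]
    by (simp add: norm_mult algebra_simps)
  then have "cmod (\<Sum>i=1..N. of_real (d\<psi> i x) * (L 1 ^^ n) h (\<psi> i x))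
      \<le> (\<Sum>i=1..N. B * (d\<psi> i x * iter_density n (\<psi> i x)))"
    by (rule sum_norm_le)
  then show ?case
    unfolding iter_density.simps sum_distrib_left funpow.simps o_apply L_inside[OF Suc.prems] by simp
qed

lemma L_in_C_space_0:
  assumes "h \<in> C_space 0"
  shows "L k h \<in> C_space 0"
proof -
  have "continuous_on {0..1} (\<lambda>x. \<Sum>i=1..N. of_real (d\<psi> i x ^ k) * h (\<psi> i x))"
  proof (intro continuous_intros)
    fix i assume i: "i \<in> {1..N}"
    show "continuous_on {0..1} (d\<psi> i)"
      by (rule deriv_continuous[OF i])
    have "continuous_on {0..1} (\<psi> i)"
      using branch_deriv[OF i] by (rule DERIV_continuous_on)
    moreover have "\<psi> i ` {0..1} \<subseteq> {0..1}"
      using maps_to[OF i] by auto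
    ultimately show "continuous_on {0..1} (\<lambda>x. h (\<psi> i x))"
      using C_space_continuous[OF assms] by (metis continuous_on_compose2)
  qed
  then have "continuous_on {0..1} (L k h)"
    by (rule continuous_on_eq) (simp add: L_def)
  then show ?thesis by (simp add: C_space_0_iff L_outside)
qed

lemma L_power_in_C_space_0: "h \<in> C_space 0 \<Longrightarrow> (L k ^^ n) h \<in> C_space 0"
  by (induction n) (auto intro: L_in_C_space_0)

lemma L_power_add: "(L k ^^ n) (\<lambda>x. g x + h x) = (\<lambda>x. (L k ^^ n) g x + (L k ^^ n) h x)"
  by (induction n) (simp_all add: L_add)

lemma L_power_mult: "(L k ^^ n) (\<lambda>x. c * h x) = (\<lambda>x. c * (L k ^^ n) h x)"
  by (induction n) (simp_all add: L_mult)

text \<open>All powers of the derivative-weighted operator are bounded by the same constant in the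
  supremum norm, so its resolvent outside the closed unit disc is the Neumann series.\<close>

theorem spectrum_C_0:
  assumes "0 \<le> K"
  shows "op_spectrum (C_space 0) (C_norm 0) (L 1) \<subseteq> {z. cmod z \<le> 1}"
proof (rule subsetI, rule ccontr)
  fix z assume z_spec: "z \<in> op_spectrum (C_space 0) (C_norm 0) (L 1)"
    and "z \<notin> {z. cmod z \<le> 1}"
  then have z: "cmod z > 1" by simp
  then have z0: "z \<noteq> 0" by auto
  define A where "A = exp (K / (1 - q))"
  have powers_le: "cmod ((L 1 ^^ n) h x) \<le> A * C_norm 0 h"
    if h: "h \<in> C_space 0" for n h x
  proof (cases "x \<in> {0..1}")
    case True
    have "cmod ((L 1 ^^ n) h x) \<le> C_norm 0 h * iter_density n x"
      by (rule L_power_le[OF cmod_le_C_norm_0[OF h] True])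
    also have "\<dots> \<le> C_norm 0 h * A"
      unfolding A_def using iter_density_le[OF assms True] C_norm_nonneg[OF h] by (rule mult_left_mono)
    finally show ?thesis by (simp add: mult.commute)
  next
    case False
    then show ?thesis
      using C_space_outside[OF L_power_in_C_space_0[OF h]] C_norm_nonneg[OF h] by (simp add: A_def)
  qed
  \<comment> \<open>The terms of the Neumann series and their majorants.\<close>
  define t where "t h n x = (L 1 ^^ n) h x / z ^ Suc n" for h n x
  define R where "R h x = (\<Sum>n. t h n x)" for h x
  define M where "M h n = A * C_norm 0 h * inverse (cmod z) ^ Suc n" for h n
  have t_le: "cmod (t h n x) \<le> M h n" if "h \<in> C_space 0" for h n x
    using divide_right_mono[OF powers_le[OF that, of n x], of "cmod z ^ Suc n"]
    by (simp add: t_def M_def norm_divide norm_inverse norm_mult norm_power divide_inverse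
        power_inverse)
  have M_sums: "M h sums (A * C_norm 0 h * (inverse (cmod z) / (1 - inverse (cmod z))))" for h
  proof -
    have "(\<lambda>n. inverse (cmod z) ^ n) sums (1 / (1 - inverse (cmod z)))"
      using z by (intro geometric_sums) (simp add: inverse_less_1_iff)
    from sums_mult[OF this, of "A * C_norm 0 h * inverse (cmod z)"]
    show ?thesis by (simp add: M_def[abs_def] mult.assoc)
  qed
  have t_summable: "summable (\<lambda>n. t h n x)" if "h \<in> C_space 0" for h x
    by (rule summable_comparison_test'[OF sums_summable[OF M_sums[of h]], of 0])
      (rule t_le[OF that])
  have t_tendsto: "(\<lambda>n. z * t h n x) \<longlonglongrightarrow> 0" if "h \<in> C_space 0" for h x
    using tendsto_mult_right_zero[OF summable_LIMSEQ_zero[OF t_summable[OF that]]] by blast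
  have z_t_Suc: "z * t h (Suc n) x = (L 1 ^^ Suc n) h x / z ^ Suc n" for h n x
    using z0 by (simp add: t_def)
  have z_t_0: "z * t h 0 x = h x" for h x
    using z0 by (simp add: t_def)
  \<comment> \<open>Both inverse properties of the Neumann series amount to this telescoping sum.\<close>
  have telescope: "(\<lambda>n. z * t h n x - z * t h (Suc n) x) sums h x" if "h \<in> C_space 0" for h x
    using telescope_sums'[OF t_tendsto[OF that]] by (simp add: z_t_0)

  have R_in: "R h \<in> C_space 0" if h: "h \<in> C_space 0" for h
  proof -
    have "uniform_limit {0..1} (\<lambda>n x. \<Sum>i<n. t h i x) (R h) sequentially"
      unfolding R_def[abs_def] using t_le[OF h] M_sums[of h]
      by (intro Weierstrass_m_test[where M = "M h"]) (auto simp: sums_iff)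
    moreover have "continuous_on {0..1} (\<lambda>x. \<Sum>i<n. t h i x)" for n
      unfolding t_def[abs_def]
      using C_space_continuous[OF L_power_in_C_space_0[OF h]] z0
      by (intro continuous_intros) auto
    ultimately have "continuous_on {0..1} (R h)"
      by (intro uniform_limit_theorem[where F = sequentially]) auto
    moreover have "R h x = 0" if "x \<notin> {0..1}" for x
      using C_space_outside[OF L_power_in_C_space_0[OF h] that] by (simp add: R_def t_def)
    ultimately show ?thesis by (simp add: C_space_0_iff)
  qed

  have L_R: "L 1 (R h) x = (\<Sum>n. z * t h (Suc n) x)" if h: "h \<in> C_space 0" for h x
  proof (cases "x \<in> {0..1}")
    case True
    have "(\<Sum>n. z * t h (Suc n) x) = (\<Sum>n. \<Sum>i=1..N. of_real (d\<psi> i x) * t h n (\<psi> i x))"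
      unfolding z_t_Suc using True by (simp add: L_def t_def sum_divide_distrib)
    also have "\<dots> = (\<Sum>i=1..N. \<Sum>n. of_real (d\<psi> i x) * t h n (\<psi> i x))"
      by (intro suminf_sum summable_mult t_summable h)
    also have "\<dots> = L 1 (R h) x"
      using True suminf_mult[OF t_summable[OF h]] by (simp add: L_def R_def)
    finally show ?thesis by simp
  next
    case False
    then show ?thesis by (simp add: L_outside z_t_Suc)
  qed

  have right_inverse: "(\<lambda>x. z * R h x - L 1 (R h) x) = h" if h: "h \<in> C_space 0" for h
  proof
    fix x
    have "summable (\<lambda>n. z * t h n x)"
      by (intro summable_mult t_summable h)
    moreover from this have "summable (\<lambda>n. z * t h (Suc n) x)"
      by (subst summable_Suc_iff)
    moreover have "z * R h x = (\<Sum>n. z * t h n x)"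
      unfolding R_def using suminf_mult[OF t_summable[OF h]] by simp
    ultimately have "z * R h x - L 1 (R h) x = (\<Sum>n. z * t h n x - z * t h (Suc n) x)"
      using L_R[OF h] by (simp add: suminf_diff)
    then show "z * R h x - L 1 (R h) x = h x"
      using telescope[OF h, of x] by (simp add: sums_iff)
  qed

  have left_inverse: "R (\<lambda>x. z * h x - L 1 h x) = h" if h: "h \<in> C_space 0" for h
  proof
    fix x
    have "t (\<lambda>x. z * h x - L 1 h x) n x = z * t h n x - z * t h (Suc n) x" for n
    proof -
      have "(L 1 ^^ n) (\<lambda>x. z * h x - L 1 h x) = (L 1 ^^ n) (\<lambda>x. z * h x + (- 1) * L 1 h x)"
        by simp
      also have "\<dots> = (\<lambda>x. z * (L 1 ^^ n) h x + (- 1) * (L 1 ^^ n) (L 1 h) x)"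
        by (simp only: L_power_add L_power_mult)
      also have "(L 1 ^^ n) (L 1 h) = (L 1 ^^ Suc n) h"
        by (simp only: funpow_Suc_right o_apply)
      finally show ?thesis
        unfolding z_t_Suc by (simp add: t_def diff_divide_distrib)
    qed
    then show "R (\<lambda>x. z * h x - L 1 h x) x = h x"
      using telescope[OF h, of x] by (simp add: R_def sums_iff)
  qed

  have R_add: "R (\<lambda>x. g x + h x) = (\<lambda>x. R g x + R h x)"
    if "g \<in> C_space 0" "h \<in> C_space 0" for g h
    using suminf_add[OF t_summable[OF that(1)] t_summable[OF that(2)]]
    by (auto simp: R_def t_def L_power_add add_divide_distrib)
  have R_mult: "R (\<lambda>x. c * h x) = (\<lambda>x. c * R h x)" if "h \<in> C_space 0" for c h
    using suminf_mult[OF t_summable[OF that], of c]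
    by (auto simp: R_def t_def L_power_mult)
  have R_bound: "C_norm 0 (R h) \<le> (A * (inverse (cmod z) / (1 - inverse (cmod z)))) * C_norm 0 h"
    if h: "h \<in> C_space 0" for h
  proof (rule C_norm_0_le)
    fix x :: real assume "x \<in> {0..1}"
    have "cmod (R h x) \<le> (\<Sum>n. M h n)"
      unfolding R_def using t_le[OF h] M_sums[of h] by (intro norm_suminf_le) (auto simp: sums_iff)
    then show "cmod (R h x) \<le> (A * (inverse (cmod z) / (1 - inverse (cmod z)))) * C_norm 0 h"
      using M_sums[of h] by (simp add: sums_iff algebra_simps)
  qed
  have "bounded_operator_on (C_space 0) (C_norm 0) R"
    unfolding bounded_operator_on_def using R_in R_add R_mult R_bound by blast
  then show False
    using z_spec left_inverse right_inverse unfolding op_spectrum_def by blast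
qed

end

section \<open>Inverse branches of an expanding map\<close>

text \<open>The difference quotients of \<open>\<psi>\<close> are reciprocals of those of \<open>g\<close>. Working within \<open>S\<close> and \<open>T\<close>
  covers the one-sided derivatives at the end points of the branches.\<close>

lemma inverse_has_derivative_within:
  fixes g \<psi> :: "real \<Rightarrow> real"
  assumes g: "(g has_real_derivative d) (at (\<psi> x) within S)" and "d \<noteq> 0"
    and cont: "continuous_on T \<psi>" and "x \<in> T"
    and in_S: "\<And>y. y \<in> T \<Longrightarrow> \<psi> y \<in> S" and inv: "\<And>y. y \<in> T \<Longrightarrow> g (\<psi> y) = y"
  shows "(\<psi> has_real_derivative inverse d) (at x within T)"
proof -
  have ev: "\<forall>\<^sub>F y in at x within T. y \<in> T \<and> y \<noteq> x"
    by (simp add: eventually_at_filter)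
  then have "\<forall>\<^sub>F y in at x within T. \<psi> y \<in> S \<and> \<psi> y \<noteq> \<psi> x"
    by eventually_elim (use in_S inv \<open>x \<in> T\<close> in metis)
  moreover have "(\<psi> \<longlongrightarrow> \<psi> x) (at x within T)"
    using cont \<open>x \<in> T\<close> by (auto simp: continuous_on_def)
  ultimately have "filterlim \<psi> (at (\<psi> x) within S) (at x within T)"
    by (simp add: filterlim_at)
  moreover have "((\<lambda>s. (g s - g (\<psi> x)) / (s - \<psi> x)) \<longlongrightarrow> d) (at (\<psi> x) within S)"
    using g by (simp add: has_field_derivative_iff)
  ultimately have "((\<lambda>y. (g (\<psi> y) - g (\<psi> x)) / (\<psi> y - \<psi> x)) \<longlongrightarrow> d) (at x within T)"
    by (rule filterlim_compose[rotated])
  then have "((\<lambda>y. inverse ((g (\<psi> y) - g (\<psi> x)) / (\<psi> y - \<psi> x))) \<longlongrightarrow> inverse d) (at x within T)"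
    using \<open>d \<noteq> 0\<close> by (rule tendsto_inverse)
  then have "((\<lambda>y. (\<psi> y - \<psi> x) / (y - x)) \<longlongrightarrow> inverse d) (at x within T)"
    by (rule Lim_transform_eventually) (use ev in eventually_elim, simp add: inv \<open>x \<in> T\<close>)
  then show ?thesis by (simp add: has_field_derivative_iff)
qed

text \<open>The last conclusion is the distortion bound and is where two derivatives are used. As \<open>g\<close> is
  \<open>C\<^sup>2\<close>, its derivative is Lipschitz; being at least \<open>1\<close>, it varies between \<open>\<psi> x\<close> and \<open>\<psi> y\<close> at most by
  the factor \<open>1 + K \<bar>x - y\<bar> \<le> exp (K \<bar>x - y\<bar>)\<close>.\<close>

lemma inverse_of_C2_branch:
  fixes g :: "real \<Rightarrow> real"
  assumes "a < b" "2 \<le> r" and C: "C_on r {a..b} g" and onto: "g ` {a..b} = {0..1}"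
    and "1 < lam" and expand: "\<And>x. x \<in> {a<..<b} \<Longrightarrow> lam < deriv g x"
  defines "\<psi> \<equiv> inv_into {a..b} g"
    and "d \<equiv> \<lambda>x. vector_derivative g (at x within {a..b})"
  shows "x \<in> {0..1} \<Longrightarrow> \<psi> x \<in> {a..b}"
    and "\<psi> 0 = a" and "\<psi> 1 = b"
    and "t \<in> {a..b} \<Longrightarrow> lam \<le> d t"
    and "continuous_on {0..1} (\<lambda>x. inverse (d (\<psi> x)))"
    and "x \<in> {0..1} \<Longrightarrow> (\<psi> has_real_derivative inverse (d (\<psi> x))) (at x within {0..1})"
    and "\<exists>K\<ge>0. \<forall>x\<in>{0..1}. \<forall>y\<in>{0..1}.
      inverse (d (\<psi> x)) \<le> exp (K * \<bar>x - y\<bar>) * inverse (d (\<psi> y))"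
proof -
  obtain m where r: "r = Suc (Suc m)"
    using \<open>2 \<le> r\<close> by (metis add_2_eq_Suc le_Suc_ex)
  define d2 where "d2 x = vector_derivative d (at x within {a..b})" for x
  have diff: "g differentiable_on {a..b}" "d differentiable_on {a..b}"
    and d2_cont: "continuous_on {a..b} d2"
    using C unfolding r C_on_Suc d_def[symmetric] d2_def[abs_def]
    by (auto intro: C_on_imp_continuous_on)
  have g_deriv: "(g has_real_derivative d t) (at t within {a..b})" if "t \<in> {a..b}" for t
    using diff(1) that unfolding d_def has_real_derivative_iff_has_vector_derivative
    by (auto simp: differentiable_on_def vector_derivative_works)
  have d_deriv: "(d has_real_derivative d2 t) (at t within {a..b})" if "t \<in> {a..b}" for t
    using diff(2) that unfolding d2_def has_real_derivative_iff_has_vector_derivative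
    by (auto simp: differentiable_on_def vector_derivative_works)
  have g_cont: "continuous_on {a..b} g" and d_cont: "continuous_on {a..b} d"
    using diff by (auto intro: differentiable_imp_continuous_on)
  have g_deriv_at: "(g has_real_derivative d t) (at t)" if "t \<in> {a<..<b}" for t
    using g_deriv[of t] that at_within_interior[of t "{a..b}"] by auto
  have d_ge: "lam \<le> d t" if "t \<in> {a..b}" for t
  proof (rule continuous_ge_on_closure[where f = d and S = "{a<..<b}"])
    show "lam \<le> d s" if "s \<in> {a<..<b}" for s
      using expand[OF that] DERIV_imp_deriv[OF g_deriv_at[OF that]] by simp
  qed (use that d_cont \<open>a < b\<close> in auto)
  show "t \<in> {a..b} \<Longrightarrow> lam \<le> d t" by (rule d_ge)
  have d_pos: "0 < d t" if "t \<in> {a..b}" for t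
    using d_ge[OF that] \<open>1 < lam\<close> by simp
  have g_less: "g s < g t" if "a \<le> s" "s < t" "t \<le> b" for s t
  proof (rule DERIV_pos_imp_increasing_open[OF that(2)])
    show "\<exists>y. (g has_real_derivative y) (at x) \<and> y > 0" if "s < x" "x < t" for x
      using g_deriv_at[of x] d_pos[of x] that \<open>a \<le> s\<close> \<open>t \<le> b\<close> by auto
  qed (use g_cont that in \<open>auto intro: continuous_on_subset\<close>)
  have inj: "inj_on g {a..b}"
    by (rule linorder_inj_onI) (use g_less in fastforce)+
  have \<psi>_in: "\<psi> x \<in> {a..b}" if "x \<in> {0..1}" for x
    unfolding \<psi>_def by (rule inv_into_into) (use onto that in blast)
  then show "x \<in> {0..1} \<Longrightarrow> \<psi> x \<in> {a..b}" .
  have g_\<psi>: "g (\<psi> x) = x" if "x \<in> {0..1}" for x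
    unfolding \<psi>_def by (rule f_inv_into_f) (use onto that in blast)
  have \<psi>_g: "\<psi> (g t) = t" if "t \<in> {a..b}" for t
    unfolding \<psi>_def using inj that by (rule inv_into_f_f)
  have "g a = 0"
  proof -
    have "g a \<ge> 0" using onto \<open>a < b\<close> by force
    moreover have "g a \<le> g (\<psi> 0)"
      using g_less[of a "\<psi> 0"] \<psi>_in[of 0] by fastforce
    ultimately show ?thesis using g_\<psi>[of 0] by simp
  qed
  then show "\<psi> 0 = a" using \<psi>_g[of a] \<open>a < b\<close> by simp
  have "g b = 1"
  proof -
    have "g b \<le> 1" using onto \<open>a < b\<close> by force
    moreover have "g (\<psi> 1) \<le> g b"
      using g_less[of "\<psi> 1" b] \<psi>_in[of 1] by fastforce
    ultimately show ?thesis using g_\<psi>[of 1] by simp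
  qed
  then show "\<psi> 1 = b" using \<psi>_g[of b] \<open>a < b\<close> by simp
  have \<psi>_cont: "continuous_on {0..1} \<psi>"
    unfolding onto[symmetric] by (rule continuous_on_inv[OF g_cont]) (use \<psi>_g in auto)
  have \<psi>_deriv: "(\<psi> has_real_derivative inverse (d (\<psi> x))) (at x within {0..1})"
    if "x \<in> {0..1}" for x
    by (rule inverse_has_derivative_within[OF g_deriv[OF \<psi>_in[OF that]] _ \<psi>_cont that \<psi>_in g_\<psi>])
      (use d_pos[OF \<psi>_in[OF that]] in auto)
  then show "x \<in> {0..1} \<Longrightarrow> (\<psi> has_real_derivative inverse (d (\<psi> x))) (at x within {0..1})" .
  have "continuous_on {0..1} (\<lambda>x. d (\<psi> x))"
    using \<psi>_in by (intro continuous_on_compose2[OF d_cont \<psi>_cont]) auto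
  then show "continuous_on {0..1} (\<lambda>x. inverse (d (\<psi> x)))"
    using d_pos[OF \<psi>_in] by (intro continuous_on_inverse) force+

  obtain K where K: "\<And>t. t \<in> {a..b} \<Longrightarrow> \<bar>d2 t\<bar> \<le> K" "K \<ge> 0"
  proof -
    have "bounded (d2 ` {a..b})"
      using d2_cont by (intro compact_imp_bounded compact_continuous_image) auto
    then obtain B where "\<forall>t\<in>{a..b}. \<bar>d2 t\<bar> \<le> B"
      unfolding bounded_iff by auto
    then show thesis
      by (intro that[of "max B 0"]) (auto simp: le_max_iff_disj)
  qed
  have \<psi>_lipschitz: "\<bar>\<psi> y - \<psi> x\<bar> \<le> \<bar>x - y\<bar>" if "x \<in> {0..1}" "y \<in> {0..1}" for x y
  proof -
    have "\<bar>inverse (d (\<psi> z))\<bar> \<le> 1" if "z \<in> {0..1}" for z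
      using d_ge[OF \<psi>_in[OF that]] \<open>1 < lam\<close> by (simp add: inverse_le_1_iff)
    then show ?thesis
      using field_differentiable_bound[of "{0..1}" \<psi> "\<lambda>z. inverse (d (\<psi> z))" 1 y x] \<psi>_deriv that
      by (simp add: abs_minus_commute)
  qed
  have "inverse (d (\<psi> x)) \<le> exp (K * \<bar>x - y\<bar>) * inverse (d (\<psi> y))"
    if x: "x \<in> {0..1}" and y: "y \<in> {0..1}" for x y
  proof -
    have "d (\<psi> y) \<le> d (\<psi> x) + K * \<bar>\<psi> y - \<psi> x\<bar>"
      using field_differentiable_bound[of "{a..b}" d d2 K "\<psi> y" "\<psi> x"] d_deriv K(1) \<psi>_in[OF x]
        \<psi>_in[OF y] by (simp add: abs_le_iff)
    also have "\<dots> \<le> d (\<psi> x) + K * \<bar>x - y\<bar>"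
      using \<psi>_lipschitz[OF x y] K(2) by (simp add: mult_left_mono)
    also have "\<dots> \<le> d (\<psi> x) * (1 + K * \<bar>x - y\<bar>)"
      using mult_right_mono[of 1 "d (\<psi> x)" "K * \<bar>x - y\<bar>"] d_ge[OF \<psi>_in[OF x]] \<open>1 < lam\<close> K(2)
      by (simp add: algebra_simps)
    also have "\<dots> \<le> d (\<psi> x) * exp (K * \<bar>x - y\<bar>)"
      using d_pos[OF \<psi>_in[OF x]] by (intro mult_left_mono exp_ge_add_one_self) simp
    finally show ?thesis
      using d_pos[OF \<psi>_in[OF x]] d_pos[OF \<psi>_in[OF y]] by (simp add: field_simps)
  qed
  then show "\<exists>K\<ge>0. \<forall>x\<in>{0..1}. \<forall>y\<in>{0..1}.
      inverse (d (\<psi> x)) \<le> exp (K * \<bar>x - y\<bar>) * inverse (d (\<psi> y))"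
    using K(2) by blast
qed

lemma full_branch_properties:
  assumes f: "full_branch_expanding r N p lam f" and i: "i \<in> {1..N}"
  shows "p i < p (i + 1)"
    and "C_on r {p i..p (i + 1)} (branch p f i)"
    and "branch p f i ` {p i..p (i + 1)} = {0..1}"
    and "x \<in> {p i<..<p (i + 1)} \<Longrightarrow> lam < deriv (branch p f i) x"
proof -
  show less: "p i < p (i + 1)"
    using f i by (auto simp: full_branch_expanding_def strict_mono_on_def)
  have "\<forall>i\<in>{1..N}. \<exists>g. (\<forall>x\<in>{p i<..<p (i + 1)}. g x = f x) \<and>
      C_on r {p i..p (i + 1)} g \<and> g ` {p i..p (i + 1)} = {0..1}"
    using f unfolding full_branch_expanding_def by (elim conjE)
  from bspec[OF this i] obtain g where g: "\<forall>x\<in>{p i<..<p (i + 1)}. g x = f x"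
      "C_on r {p i..p (i + 1)} g" "g ` {p i..p (i + 1)} = {0..1}"
    by (elim exE conjE)
  have eq: "branch p f i x = g x" if "x \<in> {p i..p (i + 1)}" for x
    by (rule branch_eq_extension[OF less that bspec[OF g(1)] C_on_imp_continuous_on[OF g(2)]])
  show "C_on r {p i..p (i + 1)} (branch p f i)"
    by (rule C_on_cong[OF eq, THEN iffD2, OF _ g(2)])
  have "branch p f i ` {p i..p (i + 1)} = g ` {p i..p (i + 1)}"
    by (rule image_cong[OF refl eq])
  then show "branch p f i ` {p i..p (i + 1)} = {0..1}"
    using g(3) by simp
  show "lam < deriv (branch p f i) x" if x: "x \<in> {p i<..<p (i + 1)}"
  proof -
    have "\<forall>\<^sub>F y in nhds x. branch p f i y = f y"
      using x eq g(1) by (intro eventually_nhds_in_open[THEN eventually_mono, of "{p i<..<p (i + 1)}"]) auto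
    then have "deriv (branch p f i) x = deriv f x"
      by (intro deriv_cong_ev refl)
    then show ?thesis
      using f i x by (auto simp: full_branch_expanding_def)
  qed
qed

definition inv_branch_deriv :: "(nat \<Rightarrow> real) \<Rightarrow> (real \<Rightarrow> real) \<Rightarrow> nat \<Rightarrow> real \<Rightarrow> real" where
  "inv_branch_deriv p f i x =
     inverse (vector_derivative (branch p f i) (at (inv_branch p f i x) within {p i..p (i + 1)}))"

lemma full_branch_inverse_branches:
  assumes "2 \<le> r" and f: "full_branch_expanding r N p lam f"
  obtains K where "0 \<le> K"
    and "inverse_branches N p (inv_branch p f) (inv_branch_deriv p f) (inverse lam) K"
proof -
  have lam: "1 < lam"
    using f by (simp add: full_branch_expanding_def)
  note props = full_branch_properties[OF f]
  note inverse = inverse_of_C2_branch[OF props(1) \<open>2 \<le> r\<close> props(2,3) lam props(4),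
      folded inv_branch_def, folded inv_branch_deriv_def]
  have "\<exists>K\<ge>0. \<forall>x\<in>{0..1}. \<forall>y\<in>{0..1}. inv_branch_deriv p f i x
      \<le> exp (K * \<bar>x - y\<bar>) * inv_branch_deriv p f i y" if "i \<in> {1..N}" for i
    by (rule inverse(7)) (rule that | assumption)+
  then obtain \<kappa> where \<kappa>: "\<And>i. i \<in> {1..N} \<Longrightarrow> 0 \<le> \<kappa> i"
      "\<And>i x y. i \<in> {1..N} \<Longrightarrow> x \<in> {0..1} \<Longrightarrow> y \<in> {0..1} \<Longrightarrow> inv_branch_deriv p f i x
        \<le> exp (\<kappa> i * \<bar>x - y\<bar>) * inv_branch_deriv p f i y"
    by metis
  \<comment> \<open>Any common upper bound of the finitely many distortion constants would do.\<close>
  define K where "K = (\<Sum>i=1..N. \<kappa> i)"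
  have K: "\<kappa> i \<le> K" if "i \<in> {1..N}" for i
    unfolding K_def using that \<kappa>(1) by (intro member_le_sum) auto
  have deriv_ge: "lam \<le> vector_derivative (branch p f i)
      (at (inv_branch p f i x) within {p i..p (i + 1)})" if "i \<in> {1..N}" "x \<in> {0..1}" for i x
    using inverse(4)[of i "inv_branch p f i x"] inverse(1)[of i x] that by blast
  have deriv_bounds: "0 \<le> inv_branch_deriv p f i x" "inv_branch_deriv p f i x \<le> inverse lam"
    if "i \<in> {1..N}" "x \<in> {0..1}" for i x
    using deriv_ge[OF that] lam by (auto simp: inv_branch_deriv_def le_imp_inverse_le)
  have "inverse_branches N p (inv_branch p f) (inv_branch_deriv p f) (inverse lam) K"
  proof
    fix i assume i: "i \<in> {1..N}"
    show "inv_branch p f i 0 = p i" "inv_branch p f i 1 = p (Suc i)"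
      using inverse(2,3)[of i] i by auto
    show "continuous_on {0..1} (inv_branch_deriv p f i)"
      using inverse(5)[of i] i by blast
    fix x :: real assume x: "x \<in> {0..1}"
    have "mono_on {1..N + 1} p"
      using f unfolding full_branch_expanding_def by (blast intro: strict_mono_on_imp_mono_on)
    then have "p 1 \<le> p i" "p (i + 1) \<le> p (N + 1)"
      using i by (auto intro: mono_onD)
    then show "inv_branch p f i x \<in> {0..1}"
      using inverse(1)[of i x] i x f by (auto simp: full_branch_expanding_def)
    show "(inv_branch p f i has_real_derivative inv_branch_deriv p f i x) (at x within {0..1})"
      using inverse(6)[of i x] i x by blast
    show "0 \<le> inv_branch_deriv p f i x" "inv_branch_deriv p f i x \<le> inverse lam"
      using deriv_bounds[OF i x] by auto
    fix y :: real assume y: "y \<in> {0..1}"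
    have "inv_branch_deriv p f i x \<le> exp (\<kappa> i * \<bar>x - y\<bar>) * inv_branch_deriv p f i y"
      by (rule \<kappa>(2)[OF i x y])
    also have "\<dots> \<le> exp (K * \<bar>x - y\<bar>) * inv_branch_deriv p f i y"
      using K[OF i] deriv_bounds[OF i y] by (simp add: mult_right_mono)
    finally show "inv_branch_deriv p f i x \<le> exp (K * \<bar>x - y\<bar>) * inv_branch_deriv p f i y" .
  next
    show "inverse lam < 1"
      using lam by (simp add: inverse_less_1_iff)
    show "p 1 = 0" "p (Suc N) = 1"
      using f by (auto simp: full_branch_expanding_def)
  qed
  moreover have "0 \<le> K"
    unfolding K_def by (intro sum_nonneg \<kappa>(1))
  ultimately show thesis using that by blast
qed

theorem lemma3p1:
  fixes f :: "real \<Rightarrow> real" and p :: "nat \<Rightarrow> real" and lam :: real and N r :: nat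
  assumes "2 \<le> r"
    and "full_branch_expanding r N p lam f"
  shows "op_spectrum (C_space 1) (C_norm 1) (transfer_op N p f 0)
           \<subseteq> {of_nat N} \<union> {z. cmod z \<le> 1} \<and>
         op_spectrum (C_space 2) (C_norm 2) (transfer_op N p f 0) \<inter> {z. cmod z \<ge> inverse lam}
           = {of_nat N} \<union>
             (op_spectrum (C_space 1) (C_norm 1) (transfer_op N p f 1) \<inter> {z. cmod z \<ge> inverse lam})"
proof -
  obtain K where "0 \<le> K"
    and "inverse_branches N p (inv_branch p f) (inv_branch_deriv p f) (inverse lam) K"
    using assms by (rule full_branch_inverse_branches)
  then interpret inverse_branches N p "inv_branch p f" "inv_branch_deriv p f" "inverse lam" K
    by simp
  have transfer: "transfer_op N p f k = L k" for k
    by (intro ext)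
      (simp add: transfer_op_def L_def inv_branch_deriv_def Let_def divide_inverse mult.commute
        power_inverse)
  have "cmod (of_nat N) \<ge> inverse lam"
  proof -
    have "N \<noteq> 0"
      using outer_ends by (intro notI) simp
    then show ?thesis
      using contracting by simp
  qed
  moreover have "op_spectrum (C_space 1) (C_norm 1) (L 0)
      = insert (of_nat N) (op_spectrum (C_space 0) (C_norm 0) (L 1))"
    using spectrum_Suc[of 0] by simp
  moreover have "op_spectrum (C_space 2) (C_norm 2) (L 0)
      = insert (of_nat N) (op_spectrum (C_space 1) (C_norm 1) (L 1))"
    using spectrum_Suc[of 1] by (simp add: numeral_2_eq_2)
  ultimately show ?thesis
    unfolding transfer using spectrum_C_0[OF \<open>0 \<le> K\<close>] by auto
qed

end
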